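(* The parameter $\mathrm{egd}(\cdot)$ is minor monotone. That is, for any graph $G$ and any edge $e$ of $G$, $$\mathrm{egd}(G\setminus e)\le \mathrm{egd}(G)\quad\text{and}\quad \mathrm{egd}(G/e)\le \mathrm{egd}(G).$$
   Context: All graphs are finite and simple. $G\setminus e$ is obtained from $G$ by deleting the edge $e$; $G/e$ is obtained by contracting $e=\{u,v\}$, i.e., replacing $u$ and $v$ by a new node adjacent to all the neighbors of $u$ and $v$. Notation: $[n]=\{1,\dots,n\}$; $X\succeq 0$ means $X$ is a real symmetric positive semidefinite matrix. Extreme Gram dimension: for a graph $G=([n],E)$, $\mathrm{egd}(G)$ is the smallest integer $r\ge 1$ such that for every $w\in\mathbb{R}^E$ the semidefinite program $\max\ \sum_{ij\in E}w_{ij}X_{ij}$ subject to $X_{ii}=1$ $(i\in[n])$, $X\succeq 0$ ($X$ an $n\times n$ symmetric matrix) has an optimal solution of rank at most $r$. *)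

theory Defs
  imports Complex_Main "Jordan_Normal_Form.DL_Rank"
begin

text \<open>A graph is a pair \<open>(n, E)\<close>. Following the indexing of matrices, the node set
  \<open>[n]\<close> is represented by \<open>{0..<n}\<close>. An edge is a set of two distinct nodes.\<close>

type_synonym graph = "nat \<times> nat set set"

definition simple_graph :: "graph \<Rightarrow> bool" where
  "simple_graph G \<longleftrightarrow> (\<forall>e\<in>snd G. e \<subseteq> {0..<fst G} \<and> card e = 2)"

definition delete_edge :: "graph \<Rightarrow> nat set \<Rightarrow> graph" where
  "delete_edge G e = (fst G, snd G - {e})"

text \<open>For \<open>u < v\<close>, the map below identifies \<open>u\<close> and \<open>v\<close> and is otherwise injective. The new node
  keeps the label \<open>u\<close>, and the labels above \<open>v\<close> move down by one, so that
  \<open>{0..<n}\<close> is mapped onto \<open>{0..<n - 1}\<close>.\<close>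

definition merge :: "nat \<Rightarrow> nat \<Rightarrow> nat \<Rightarrow> nat" where
  "merge u v i = (if i = v then u else if i > v then i - 1 else i)"

text \<open>The contracted edge is the only one that would become a loop, and parallel edges are
  identified because edges form a set.\<close>

definition contract_edge :: "graph \<Rightarrow> nat set \<Rightarrow> graph" where
  "contract_edge G e =
     (fst G - 1, (\<lambda>f. merge (Min e) (Max e) ` f) ` (snd G - {e}))"

definition pos_semidef :: "nat \<Rightarrow> real mat \<Rightarrow> bool" where
  "pos_semidef n X \<longleftrightarrow>
     X \<in> carrier_mat n n \<and> transpose_mat X = X \<and>
     (\<forall>y\<in>carrier_vec n. 0 \<le> y \<bullet> (X *\<^sub>v y))"

definition sdp_feasible :: "nat \<Rightarrow> real mat \<Rightarrow> bool" where
  "sdp_feasible n X \<longleftrightarrow> pos_semidef n X \<and> (\<forall>i<n. X $$ (i, i) = 1)"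

text \<open>Each edge contributes once, through its ordered pair with \<open>i < j\<close>.\<close>

definition sdp_objective :: "graph \<Rightarrow> (nat set \<Rightarrow> real) \<Rightarrow> real mat \<Rightarrow> real" where
  "sdp_objective G w X =
     (\<Sum>(i, j)\<in>{(i, j). i < j \<and> {i, j} \<in> snd G}. w {i, j} * X $$ (i, j))"

text \<open>Only the values of \<open>w\<close> on the edges matter, so that \<open>w\<close> ranges over all edge weights.\<close>

definition egd :: "graph \<Rightarrow> nat" where
  "egd G = (LEAST r. 1 \<le> r \<and>
     (\<forall>w. \<exists>X. is_arg_max (sdp_objective G w) (sdp_feasible (fst G)) X \<and>
              vec_space.rank (fst G) X \<le> r))"

end

theory Submission
  imports Defs
begin

text \<open>An upper bound \<open>r\<close> for the rank of some optimal solution, uniform in the weights, is inherited by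
  \<open>G\<close> with an edge \<open>e\<close> removed, since giving \<open>e\<close> weight zero has the same effect on the objective
  as deleting it (\<open>optimal_rank_bound_delete_edge\<close>).

  For the contraction of \<open>e = {u, v}\<close>, observe that a feasible matrix is a Gram matrix of unit vectors,
  so that an entry \<open>X\<^sub>u\<^sub>v = 1\<close> forces the vectors of \<open>u\<close> and \<open>v\<close> to coincide. Feasible
  matrices for the contracted graph therefore correspond to the feasible matrices for \<open>G\<close> with
  \<open>X\<^sub>u\<^sub>v = 1\<close>, and this constraint is enforced by a large weight on \<open>e\<close>. Concretely, weights \<open>w\<close> on
  the contracted graph are spread over the edges of \<open>G\<close>, and \<open>e\<close> receives the weight \<open>k\<close>. For each
  \<open>k\<close> there is an optimal \<open>X\<^sub>k\<close> of rank at most \<open>r\<close>. Comparison with the matrices that already satisfy the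
  constraint yields \<open>k (1 - (X\<^sub>k)\<^sub>u\<^sub>v) \<le> C\<close> with \<open>C\<close> independent of \<open>k\<close>. Feasible matrices form a
  compact set (\<open>sdp_feasible_compact\<close>), so a subsequence converges to a feasible \<open>Z\<close> with
  \<open>Z\<^sub>u\<^sub>v = 1\<close>, whose restriction to the nodes other than \<open>v\<close> is optimal for \<open>w\<close>
  (\<open>optimal_rank_bound_contract_edge\<close>).

  The rank does not increase in this process: it is lower semicontinuous (\<open>rank_limit_le\<close>), and it
  does not grow when rows and columns are dropped (\<open>rank_pullback_le\<close>). Compactness also provides optimal
  solutions for all weights (\<open>sdp_optimum_exists\<close>), so that \<open>egd\<close> is the least element of a nonempty set
  and itself satisfies the bound it is defined by (\<open>egd_attained\<close>).\<close>

section \<open>Rank and independent columns\<close>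

definition select_cols :: "'a mat \<Rightarrow> (nat \<Rightarrow> nat) \<Rightarrow> nat \<Rightarrow> 'a mat" where
  "select_cols A f c = mat (dim_row A) c (\<lambda>(i, j). A $$ (i, f j))"

lemma select_cols_carrier [simp]:
  "A \<in> carrier_mat n nc \<Longrightarrow> select_cols A f c \<in> carrier_mat n c"
  by (simp add: select_cols_def)

lemma col_select_cols:
  "\<lbrakk>A \<in> carrier_mat n nc; j < c; f j < nc\<rbrakk> \<Longrightarrow> col (select_cols A f c) j = col A (f j)"
  by (intro eq_vecI) (auto simp: select_cols_def)

definition trivial_kernel :: "nat \<Rightarrow> nat \<Rightarrow> 'a::field mat \<Rightarrow> bool" where
  "trivial_kernel n c B \<longleftrightarrow> (\<forall>x\<in>carrier_vec c. B *\<^sub>v x = 0\<^sub>v n \<longrightarrow> x = 0\<^sub>v c)"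

lemma trivial_kernel_distinct_cols:
  fixes B :: "'a::field mat"
  assumes B: "B \<in> carrier_mat n c" and ker: "trivial_kernel n c B"
  shows "distinct (cols B)"
proof (rule ccontr)
  assume "\<not> distinct (cols B)"
  then obtain i j where ij: "i < c" "j < c" "i \<noteq> j" "col B i = col B j"
    using B by (auto simp: distinct_conv_nth)
  define x :: "'a vec" where "x = unit_vec c i - unit_vec c j"
  have x: "x \<in> carrier_vec c" by (simp add: x_def)
  have "B *\<^sub>v x = B *\<^sub>v unit_vec c i - B *\<^sub>v unit_vec c j"
    unfolding x_def using B by (intro mult_minus_distrib_mat_vec) auto
  also have "\<dots> = col B i - col B j"
    using B ij(1,2) by (intro arg_cong2[of _ _ _ _ minus] eq_vecI) auto
  also have "\<dots> = 0\<^sub>v n"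
    using B ij by (metis col_dim minus_cancel_vec carrier_matD(1))
  finally have "x = 0\<^sub>v c"
    using ker x by (simp add: trivial_kernel_def)
  then have "x $ i = 0" using ij by simp
  then show False using ij by (simp add: x_def)
qed

text \<open>Linear independence of a set of columns, as in the definition of the rank, is cumbersome to compare
  between different matrices, because the columns themselves change. Selecting columns by their indices
  and expressing independence by the kernel makes the selection transferable to another matrix.\<close>

lemma rank_ge_iff_select_cols:
  fixes A :: "'a::field mat"
  assumes A: "A \<in> carrier_mat n nc"
  shows "c \<le> vec_space.rank n A \<longleftrightarrow>
    (\<exists>f. (\<forall>j<c. f j < nc) \<and> trivial_kernel n c (select_cols A f c))"
proof -
  interpret vec_space "TYPE('a)" n .
  show ?thesis
  proof
    assume le: "c \<le> rank A"
    obtain S where S: "maximal S (\<lambda>T. T \<subseteq> set (cols A) \<and> lin_indpt T)"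
      using maximal_exists_superset[of "set (cols A)" "\<lambda>T. T \<subseteq> set (cols A) \<and> lin_indpt T" "{}"]
        finite_lin_indpt2 by auto
    then have S': "S \<subseteq> set (cols A)" "lin_indpt S" by (auto simp: maximal_def)
    have "card S = rank A" using rank_card_indpt[OF A S] by simp
    then obtain T where T: "T \<subseteq> S" "card T = c" "finite T"
      using le obtain_subset_with_card_n by metis
    obtain ts where ts: "set ts = T" "distinct ts" "length ts = c"
      using T finite_distinct_list distinct_card by metis
    have "\<exists>k<nc. col A k = ts ! j" if "j < c" for j
    proof -
      have "ts ! j \<in> T" using that ts(1,3) nth_mem[of j ts] by simp
      then have "ts ! j \<in> set (cols A)" using T(1) S'(1) by (meson subsetD)
      then show ?thesis using A by (auto simp: in_set_conv_nth)
    qed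
    then obtain f where f: "\<And>j. j < c \<Longrightarrow> f j < nc \<and> col A (f j) = ts ! j" by metis
    let ?B = "select_cols A f c"
    have B: "?B \<in> carrier_mat n c" using A by simp
    have cols: "cols ?B = ts"
      using B f ts by (intro nth_equalityI) (auto simp: col_select_cols[OF A])
    have "lin_indpt T" using subset_li_is_li[OF S'(2) T(1)] .
    then have "trivial_kernel n c ?B"
      unfolding trivial_kernel_def using lin_depI[OF B] cols ts by auto
    with f show "\<exists>f. (\<forall>j<c. f j < nc) \<and> trivial_kernel n c (select_cols A f c)" by blast
  next
    assume "\<exists>f. (\<forall>j<c. f j < nc) \<and> trivial_kernel n c (select_cols A f c)"
    then obtain f where f: "\<And>j. j < c \<Longrightarrow> f j < nc"
      and ker: "trivial_kernel n c (select_cols A f c)" by blast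
    let ?B = "select_cols A f c"
    have B: "?B \<in> carrier_mat n c" using A by simp
    have dist: "distinct (cols ?B)" by (rule trivial_kernel_distinct_cols[OF B ker])
    have "lin_indpt (set (cols ?B))"
      using ker lin_depE[OF B _ dist] by (metis trivial_kernel_def)
    moreover have "set (cols ?B) \<subseteq> set (cols A)"
    proof
      fix y assume "y \<in> set (cols ?B)"
      then obtain j where "j < c" "y = col ?B j"
        using B by (auto simp: in_set_conv_nth)
      then show "y \<in> set (cols A)"
        using col_select_cols[OF A, of j c f] f A by (metis carrier_matD(2) cols_length cols_nth nth_mem)
    qed
    ultimately have "card (set (cols ?B)) \<le> rank A"
      using rank_ge_card_indpt[OF A] by blast
    then show "c \<le> rank A"
      using distinct_card[OF dist] B by simp
  qed
qed

text \<open>Over the reals \<open>B\<^sup>T B x = 0\<close> gives \<open>\<bar>B x\<bar>\<^sup>2 = x\<^sup>T B\<^sup>T B x = 0\<close>, so that \<open>B\<close> and its Gram matrix have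
  the same kernel. This turns independence of columns into the nonvanishing of a polynomial in the entries.\<close>

lemma trivial_kernel_iff_gram_det:
  fixes B :: "real mat"
  assumes B: "B \<in> carrier_mat n c"
  shows "trivial_kernel n c B \<longleftrightarrow> det (transpose_mat B * B) \<noteq> 0"
proof -
  have G: "transpose_mat B * B \<in> carrier_mat c c" using B by simp
  have "(transpose_mat B * B) *\<^sub>v x = 0\<^sub>v c \<longleftrightarrow> B *\<^sub>v x = 0\<^sub>v n" if x: "x \<in> carrier_vec c" for x
  proof
    assume *: "(transpose_mat B * B) *\<^sub>v x = 0\<^sub>v c"
    have Bx: "B *\<^sub>v x \<in> carrier_vec n" using B x by simp
    have "(B *\<^sub>v x) \<bullet> (B *\<^sub>v x) = x \<bullet> (transpose_mat B *\<^sub>v (B *\<^sub>v x))"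
      using transpose_vec_mult_scalar[OF B x Bx] Bx x B
      by (metis comm_scalar_prod mult_mat_vec_carrier transpose_carrier_mat)
    also have "transpose_mat B *\<^sub>v (B *\<^sub>v x) = 0\<^sub>v c"
      using * B x by (metis assoc_mult_mat_vec transpose_carrier_mat)
    finally have "(B *\<^sub>v x) \<bullet> (B *\<^sub>v x) = 0" using x by simp
    then have "(\<Sum>i<n. ((B *\<^sub>v x) $ i)\<^sup>2) = 0"
      using Bx B by (simp add: scalar_prod_def power2_eq_square atLeast0LessThan)
    then have "\<forall>i<n. (B *\<^sub>v x) $ i = 0"
      by (subst (asm) sum_nonneg_eq_0_iff) auto
    then show "B *\<^sub>v x = 0\<^sub>v n" using B by (intro eq_vecI) auto
  next
    assume "B *\<^sub>v x = 0\<^sub>v n"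
    then show "(transpose_mat B * B) *\<^sub>v x = 0\<^sub>v c"
      using B x by (auto simp: assoc_mult_mat_vec[of _ c n _ c])
  qed
  then show ?thesis
    unfolding trivial_kernel_def using det_0_iff_vec_prod_zero_field[OF G] by blast
qed

definition entrywise_limit :: "nat \<Rightarrow> nat \<Rightarrow> (nat \<Rightarrow> real mat) \<Rightarrow> real mat \<Rightarrow> bool" where
  "entrywise_limit n m X Z \<longleftrightarrow>
     (\<forall>i<n. \<forall>j<m. (\<lambda>k. X k $$ (i, j)) \<longlonglongrightarrow> Z $$ (i, j))"

lemma tendsto_det:
  assumes X: "\<And>k. X k \<in> carrier_mat n n" and Z: "Z \<in> carrier_mat n n"
    and lim: "entrywise_limit n n X Z"
  shows "(\<lambda>k. det (X k)) \<longlonglongrightarrow> det Z"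
proof -
  have "(\<lambda>k. \<Sum>p\<in>{p. p permutes {0..<n}}. signof p * (\<Prod>i=0..<n. X k $$ (i, p i)))
    \<longlonglongrightarrow> (\<Sum>p\<in>{p. p permutes {0..<n}}. signof p * (\<Prod>i=0..<n. Z $$ (i, p i)))"
    using lim by (intro tendsto_intros) (auto simp: entrywise_limit_def permutes_in_image)
  then show ?thesis using det_def'[OF X] det_def'[OF Z] by simp
qed

text \<open>Columns that are independent in the limit have a nonzero Gram determinant there. By continuity the
  Gram determinant of the same columns is nonzero far out in the sequence.\<close>

lemma rank_limit_le:
  assumes X: "\<And>k. X k \<in> carrier_mat n m" and Z: "Z \<in> carrier_mat n m"
    and lim: "entrywise_limit n m X Z"
    and rank: "\<And>k. vec_space.rank n (X k) \<le> r"
  shows "vec_space.rank n Z \<le> r"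
proof -
  define c where "c = vec_space.rank n Z"
  obtain f where f: "\<And>j. j < c \<Longrightarrow> f j < m" and ker: "trivial_kernel n c (select_cols Z f c)"
    using rank_ge_iff_select_cols[OF Z, of c] by (auto simp: c_def)
  define gram where "gram Y = transpose_mat (select_cols Y f c) * select_cols Y f c" for Y :: "real mat"
  have gram: "gram Y \<in> carrier_mat c c" if "Y \<in> carrier_mat n m" for Y
    using that by (auto simp: gram_def intro!: mult_carrier_mat[of _ _ n])
  have entry: "gram Y $$ (i, j) = (\<Sum>l<n. Y $$ (l, f i) * Y $$ (l, f j))"
    if "Y \<in> carrier_mat n m" "i < c" "j < c" for Y i j
    using that by (auto simp: gram_def select_cols_def scalar_prod_def atLeast0LessThan)
  have "entrywise_limit c c (\<lambda>k. gram (X k)) (gram Z)"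
    unfolding entrywise_limit_def
  proof (intro allI impI)
    fix i j assume ij: "i < c" "j < c"
    have "(\<lambda>k. \<Sum>l<n. X k $$ (l, f i) * X k $$ (l, f j))
        \<longlonglongrightarrow> (\<Sum>l<n. Z $$ (l, f i) * Z $$ (l, f j))"
      using lim f ij by (intro tendsto_intros) (auto simp: entrywise_limit_def)
    then show "(\<lambda>k. gram (X k) $$ (i, j)) \<longlonglongrightarrow> gram Z $$ (i, j)"
      using X Z ij by (simp add: entry)
  qed
  then have "(\<lambda>k. det (gram (X k))) \<longlonglongrightarrow> det (gram Z)"
    by (intro tendsto_det[where n = c] gram X Z)
  moreover have "det (gram Z) \<noteq> 0"
    using ker trivial_kernel_iff_gram_det[of "select_cols Z f c" n c] Z by (simp add: gram_def)
  ultimately have "eventually (\<lambda>k. det (gram (X k)) \<noteq> 0) sequentially"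
    by (rule tendsto_imp_eventually_ne)
  then obtain k where "det (gram (X k)) \<noteq> 0"
    by (auto simp: eventually_sequentially)
  then have "trivial_kernel n c (select_cols (X k) f c)"
    using trivial_kernel_iff_gram_det[OF select_cols_carrier[OF X]] by (simp add: gram_def)
  then have "c \<le> vec_space.rank n (X k)"
    using rank_ge_iff_select_cols[OF X, of c] f by blast
  then show ?thesis using rank[of k] by (simp add: c_def)
qed

section \<open>Relabelling the index set of a matrix\<close>

text \<open>Relabelling along \<open>merge\<close> duplicates a row and a column, and relabelling along a section of \<open>merge\<close>
  removes a row and a column. A single notion covers both directions.\<close>

definition pullback :: "nat \<Rightarrow> (nat \<Rightarrow> nat) \<Rightarrow> 'a mat \<Rightarrow> 'a mat" where
  "pullback n f Y = mat n n (\<lambda>(i, j). Y $$ (f i, f j))"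

lemma pullback_carrier [simp]: "pullback n f Y \<in> carrier_mat n n"
  by (simp add: pullback_def)

lemma dim_pullback [simp]: "dim_row (pullback n f Y) = n" "dim_col (pullback n f Y) = n"
  by (simp_all add: pullback_def)

lemma pullback_entry [simp]: "i < n \<Longrightarrow> j < n \<Longrightarrow> pullback n f Y $$ (i, j) = Y $$ (f i, f j)"
  by (simp add: pullback_def)

text \<open>A linear relation between columns \<open>g (f j)\<close> of \<open>X\<close> restricts to the rows \<open>g i\<close>, so columns that are
  independent after relabelling come from independent columns of \<open>X\<close>.\<close>

lemma rank_pullback_le:
  fixes X :: "'a::field mat"
  assumes X: "X \<in> carrier_mat n n" and g: "\<And>i. i < p \<Longrightarrow> g i < n"
  shows "vec_space.rank p (pullback p g X) \<le> vec_space.rank n X"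
proof -
  define c where "c = vec_space.rank p (pullback p g X)"
  obtain f where f: "\<And>j. j < c \<Longrightarrow> f j < p"
    and ker: "trivial_kernel p c (select_cols (pullback p g X) f c)"
    using rank_ge_iff_select_cols[OF pullback_carrier, of c p g X] by (auto simp: c_def)
  have "trivial_kernel n c (select_cols X (g \<circ> f) c)"
    unfolding trivial_kernel_def
  proof (intro ballI impI)
    fix x :: "'a vec" assume x: "x \<in> carrier_vec c"
      and 0: "select_cols X (g \<circ> f) c *\<^sub>v x = 0\<^sub>v n"
    have "select_cols (pullback p g X) f c *\<^sub>v x = 0\<^sub>v p"
    proof (rule eq_vecI)
      fix i assume i: "i < dim_vec (0\<^sub>v p :: 'a vec)"
      have "(select_cols (pullback p g X) f c *\<^sub>v x) $ i = (select_cols X (g \<circ> f) c *\<^sub>v x) $ g i"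
        using i x X g f by (auto simp: select_cols_def scalar_prod_def)
      then show "(select_cols (pullback p g X) f c *\<^sub>v x) $ i = 0\<^sub>v p $ i"
        using 0 i g by simp
    qed (simp add: select_cols_def pullback_def)
    then show "x = 0\<^sub>v c" using ker x by (simp add: trivial_kernel_def)
  qed
  then have "c \<le> vec_space.rank n X"
    using rank_ge_iff_select_cols[OF X, of c] f g by (metis comp_apply)
  then show ?thesis by (simp add: c_def)
qed


section \<open>Feasible matrices\<close>

lemma quadratic_form:
  fixes X :: "real mat"
  assumes "X \<in> carrier_mat n n" "y \<in> carrier_vec n"
  shows "y \<bullet> (X *\<^sub>v y) = (\<Sum>i<n. \<Sum>j<n. y $ i * X $$ (i, j) * y $ j)"
proof -
  have "y \<bullet> (X *\<^sub>v y) = (\<Sum>i<n. y $ i * (X *\<^sub>v y) $ i)"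
    using assms by (simp add: scalar_prod_def atLeast0LessThan)
  also have "\<dots> = (\<Sum>i<n. y $ i * (\<Sum>j<n. X $$ (i, j) * y $ j))"
    using assms by (intro sum.cong) (simp_all add: scalar_prod_def atLeast0LessThan)
  finally show ?thesis by (simp add: sum_distrib_left mult.assoc)
qed

lemma pos_semidef_iff:
  "pos_semidef n X \<longleftrightarrow> X \<in> carrier_mat n n \<and> transpose_mat X = X \<and>
     (\<forall>y. 0 \<le> (\<Sum>i<n. \<Sum>j<n. y i * X $$ (i, j) * y j))"
proof (cases "X \<in> carrier_mat n n")
  case True
  have "(\<forall>y\<in>carrier_vec n. 0 \<le> y \<bullet> (X *\<^sub>v y)) \<longleftrightarrow>
    (\<forall>y. 0 \<le> (\<Sum>i<n. \<Sum>j<n. y i * X $$ (i, j) * y j))"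
  proof (intro iffI allI ballI)
    fix y :: "nat \<Rightarrow> real" assume "\<forall>y\<in>carrier_vec n. 0 \<le> y \<bullet> (X *\<^sub>v y)"
    then have "0 \<le> vec n y \<bullet> (X *\<^sub>v vec n y)" by simp
    then show "0 \<le> (\<Sum>i<n. \<Sum>j<n. y i * X $$ (i, j) * y j)"
      by (subst (asm) quadratic_form[OF True]) auto
  next
    fix y :: "real vec" assume "\<forall>y. 0 \<le> (\<Sum>i<n. \<Sum>j<n. y i * X $$ (i, j) * y j)"
      and "y \<in> carrier_vec n"
    then show "0 \<le> y \<bullet> (X *\<^sub>v y)" by (simp add: quadratic_form[OF True])
  qed
  then show ?thesis by (simp add: pos_semidef_def True)
qed (simp add: pos_semidef_def)

lemma sdp_feasible_carrier: "sdp_feasible n X \<Longrightarrow> X \<in> carrier_mat n n"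
  by (simp add: sdp_feasible_def pos_semidef_def)

lemma sdp_feasible_diag: "sdp_feasible n X \<Longrightarrow> i < n \<Longrightarrow> X $$ (i, i) = 1"
  by (simp add: sdp_feasible_def)

lemma sdp_feasible_sym:
  assumes "sdp_feasible n X" "i < n" "j < n"
  shows "X $$ (i, j) = X $$ (j, i)"
  using assms by (metis sdp_feasible_def pos_semidef_def carrier_matD index_transpose_mat(1))

text \<open>The quadratic form of \<open>X\<close> at \<open>a e\<^sub>i + b e\<^sub>j + c e\<^sub>k\<close>, where the indices may coincide.\<close>

lemma sdp_feasible_three_points:
  assumes X: "sdp_feasible n X" and ijk: "i < n" "j < n" "k < n"
  shows "0 \<le> a\<^sup>2 + b\<^sup>2 + c\<^sup>2 + 2 * a * b * X $$ (i, j) + 2 * a * c * X $$ (i, k) + 2 * b * c * X $$ (j, k)"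
proof -
  define y :: "nat \<Rightarrow> real" where
    "y l = (if l = i then a else 0) + (if l = j then b else 0) + (if l = k then c else 0)" for l
  have y: "(\<Sum>l<n. h l * y l) = h i * a + h j * b + h k * c" for h :: "nat \<Rightarrow> real"
    using ijk by (simp add: y_def distrib_left sum.distrib if_distrib[of "(*) _"] cong: if_cong)
  have "0 \<le> (\<Sum>l<n. \<Sum>m<n. y l * X $$ (l, m) * y m)"
    using X by (simp add: sdp_feasible_def pos_semidef_iff)
  also have "\<dots> = (\<Sum>l<n. (\<Sum>m<n. X $$ (l, m) * y m) * y l)"
    by (simp add: sum_distrib_left sum_distrib_right mult_ac)
  also have "\<dots> = (\<Sum>l<n. (X $$ (l, i) * a + X $$ (l, j) * b + X $$ (l, k) * c) * y l)"
    by (simp only: y)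
  also have "\<dots> = (X $$ (i, i) * a + X $$ (i, j) * b + X $$ (i, k) * c) * a
      + (X $$ (j, i) * a + X $$ (j, j) * b + X $$ (j, k) * c) * b
      + (X $$ (k, i) * a + X $$ (k, j) * b + X $$ (k, k) * c) * c"
    by (rule y)
  also have "\<dots> = a\<^sup>2 + b\<^sup>2 + c\<^sup>2 + 2 * a * b * X $$ (i, j) + 2 * a * c * X $$ (i, k) + 2 * b * c * X $$ (j, k)"
    using sdp_feasible_sym[OF X, of i j] sdp_feasible_sym[OF X, of i k] sdp_feasible_sym[OF X, of j k]
      sdp_feasible_diag[OF X] ijk by (simp add: algebra_simps power2_eq_square)
  finally show ?thesis .
qed

lemma sdp_feasible_abs_le_1:
  assumes X: "sdp_feasible n X" and ij: "i < n" "j < n"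
  shows "\<bar>X $$ (i, j)\<bar> \<le> 1"
  using sdp_feasible_three_points[OF X ij ij(2), of 1 1 0]
    sdp_feasible_three_points[OF X ij ij(2), of 1 "-1" 0] by simp

text \<open>In terms of Gram vectors: unit vectors with inner product 1 are equal. The proof evaluates the quadratic
  form at \<open>e\<^sub>u - e\<^sub>v - d e\<^sub>j\<close>, where \<open>d\<close> is the difference of the two entries; the value is \<open>- d\<^sup>2\<close>.\<close>

lemma sdp_feasible_entry_1_imp_rows_eq:
  assumes X: "sdp_feasible n X" and uv: "u < n" "v < n" "X $$ (u, v) = 1" and j: "j < n"
  shows "X $$ (u, j) = X $$ (v, j)"
proof -
  define d where "d = X $$ (u, j) - X $$ (v, j)"
  have "0 \<le> 1\<^sup>2 + (-1)\<^sup>2 + (- d)\<^sup>2 + 2 * 1 * (-1) * X $$ (u, v)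
      + 2 * 1 * (- d) * X $$ (u, j) + 2 * (-1) * (- d) * X $$ (v, j)"
    by (rule sdp_feasible_three_points[OF X uv(1,2) j])
  also have "\<dots> = - d\<^sup>2"
    using uv by (simp add: d_def algebra_simps power2_eq_square)
  finally have "d = 0" by simp
  then show ?thesis by (simp add: d_def)
qed

lemma sdp_feasible_one_mat: "sdp_feasible n (1\<^sub>m n)"
proof -
  have "(\<Sum>i<n. \<Sum>j<n. y i * (1\<^sub>m n :: real mat) $$ (i, j) * y j) = (\<Sum>i<n. y i * y i)" for y
    by (auto simp: if_distrib[of "(*) _"] if_distribR if_distrib[of "\<lambda>x. x * _"] intro!: sum.cong cong: if_cong)
  then show ?thesis
    by (auto simp: sdp_feasible_def pos_semidef_iff intro!: sum_nonneg)
qed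

text \<open>The quadratic form of the relabelled matrix at \<open>y\<close> is that of \<open>Y\<close> at the vector \<open>z\<close> that sums \<open>y\<close> over
  the fibres of \<open>f\<close>.\<close>

lemma sdp_feasible_pullback:
  assumes Y: "sdp_feasible p Y" and f: "\<And>i. i < n \<Longrightarrow> f i < p"
  shows "sdp_feasible n (pullback n f Y)"
proof -
  have "0 \<le> (\<Sum>i<n. \<Sum>j<n. y i * pullback n f Y $$ (i, j) * y j)" for y
  proof -
    define z where "z a = (\<Sum>i | i < n \<and> f i = a. y i)" for a
    have group: "(\<Sum>a<p. h a * z a) = (\<Sum>i<n. h (f i) * y i)" for h
    proof -
      have "(\<Sum>i<n. h (f i) * y i) = (\<Sum>a<p. \<Sum>i | i \<in> {..<n} \<and> f i = a. h (f i) * y i)"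
        using f by (intro sum.group[symmetric]) auto
      also have "\<dots> = (\<Sum>a<p. h a * z a)"
        by (auto simp: z_def sum_distrib_left intro!: sum.cong)
      finally show ?thesis by simp
    qed
    have "0 \<le> (\<Sum>a<p. \<Sum>b<p. z a * Y $$ (a, b) * z b)"
      using Y by (simp add: sdp_feasible_def pos_semidef_iff)
    also have "\<dots> = (\<Sum>a<p. (\<Sum>b<p. Y $$ (a, b) * z b) * z a)"
      by (simp add: sum_distrib_left sum_distrib_right mult_ac)
    also have "\<dots> = (\<Sum>i<n. (\<Sum>j<n. Y $$ (f i, f j) * y j) * y i)"
      by (simp only: group)
    also have "\<dots> = (\<Sum>i<n. \<Sum>j<n. y i * pullback n f Y $$ (i, j) * y j)"
      by (auto simp: sum_distrib_left sum_distrib_right mult_ac intro!: sum.cong)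
    finally show ?thesis .
  qed
  moreover have "transpose_mat (pullback n f Y) = pullback n f Y"
    using sdp_feasible_sym[OF Y] f by (intro eq_matI) auto
  ultimately show ?thesis
    using sdp_feasible_diag[OF Y] f by (auto simp: sdp_feasible_def pos_semidef_iff)
qed

lemma finite_family_convergent_subseq:
  fixes a :: "nat \<Rightarrow> 'b \<Rightarrow> real"
  assumes "finite S" and bound: "\<And>k p. p \<in> S \<Longrightarrow> \<bar>a k p\<bar> \<le> B"
  shows "\<exists>s :: nat \<Rightarrow> nat. strict_mono s \<and> (\<forall>p\<in>S. convergent (\<lambda>k. a (s k) p))"
  using assms
proof (induction S)
  case empty
  show ?case by (intro exI[of _ id]) (simp add: strict_mono_def)
next
  case (insert q S)
  then obtain s :: "nat \<Rightarrow> nat" where s: "strict_mono s" "\<And>p. p \<in> S \<Longrightarrow> convergent (\<lambda>k. a (s k) p)"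
    by auto
  obtain t :: "nat \<Rightarrow> nat" where t: "strict_mono t" "monoseq (\<lambda>k. a (s (t k)) q)"
    using seq_monosub[of "\<lambda>k. a (s k) q"] by auto
  have "Bseq (\<lambda>k. a (s (t k)) q)"
    using insert.prems by (intro BseqI'[of _ B]) auto
  then have "convergent (\<lambda>k. a (s (t k)) q)"
    using t by (intro Bseq_monoseq_convergent)
  moreover have "convergent (\<lambda>k. a (s (t k)) p)" if "p \<in> S" for p
    using convergent_subseq_convergent[OF s(2)[OF that] t(1)] by (simp add: comp_def)
  ultimately show ?case
    using s t strict_mono_o[of s t] by (intro exI[of _ "s \<circ> t"]) (auto simp: comp_def)
qed

text \<open>Entries of feasible matrices lie in \<open>[-1, 1]\<close>, so Bolzano-Weierstrass applies to the finitely many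
  entries, and the conditions defining feasibility are closed.\<close>

lemma sdp_feasible_compact:
  assumes X: "\<And>k. sdp_feasible n (X k)"
  obtains s :: "nat \<Rightarrow> nat" and Z where
    "strict_mono s" "sdp_feasible n Z" "entrywise_limit n n (\<lambda>k. X (s k)) Z"
proof -
  obtain s :: "nat \<Rightarrow> nat" where s: "strict_mono s"
    and conv: "\<forall>p\<in>{..<n} \<times> {..<n}. convergent (\<lambda>k. X (s k) $$ p)"
    using finite_family_convergent_subseq[of "{..<n} \<times> {..<n}" "\<lambda>k p. X k $$ p" 1]
      sdp_feasible_abs_le_1[OF X] by auto
  define Z where "Z = mat n n (\<lambda>p. lim (\<lambda>k. X (s k) $$ p))"
  have lim: "(\<lambda>k. X (s k) $$ (i, j)) \<longlonglongrightarrow> Z $$ (i, j)" if "i < n" "j < n" for i j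
    using conv that by (auto simp: Z_def convergent_LIMSEQ_iff)
  have "0 \<le> (\<Sum>i<n. \<Sum>j<n. y i * Z $$ (i, j) * y j)" for y
  proof (rule LIMSEQ_le_const)
    show "(\<lambda>k. \<Sum>i<n. \<Sum>j<n. y i * X (s k) $$ (i, j) * y j)
        \<longlonglongrightarrow> (\<Sum>i<n. \<Sum>j<n. y i * Z $$ (i, j) * y j)"
      by (intro tendsto_intros lim) auto
    show "\<exists>N. \<forall>k\<ge>N. 0 \<le> (\<Sum>i<n. \<Sum>j<n. y i * X (s k) $$ (i, j) * y j)"
      using X by (auto simp: sdp_feasible_def pos_semidef_iff)
  qed
  moreover have "transpose_mat Z = Z"
    using sdp_feasible_sym[OF X] by (intro eq_matI) (auto simp: Z_def intro!: arg_cong[of _ _ lim])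
  moreover have "Z $$ (i, i) = 1" if "i < n" for i
    using lim[OF that that] sdp_feasible_diag[OF X that] by (simp add: LIMSEQ_const_iff)
  ultimately have "sdp_feasible n Z"
    by (auto simp: sdp_feasible_def pos_semidef_iff Z_def)
  with s lim that show ?thesis by (simp add: entrywise_limit_def)
qed


section \<open>The semidefinite program of a graph\<close>

text \<open>The entry that the objective pairs with the weight of an edge. It allows the objective to be written as
  a sum over edges, which behave better under relabelling than ordered pairs.\<close>

definition edge_entry :: "'a mat \<Rightarrow> nat set \<Rightarrow> 'a" where
  "edge_entry X f = X $$ (Min f, Max f)"

lemma simple_graph_edgeE:
  assumes "simple_graph G" "f \<in> snd G"
  obtains i j where "f = {i, j}" "i < j" "j < fst G" "Min f = i" "Max f = j"
proof -
  have "card f = 2" "f \<subseteq> {0..<fst G}" using assms by (auto simp: simple_graph_def)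
  then obtain a b where "f = {a, b}" "a \<noteq> b" by (auto simp: card_2_iff)
  then show ?thesis
    using that[of "min a b" "max a b"] \<open>f \<subseteq> {0..<fst G}\<close>
    by (cases "a < b") (auto simp: min_def max_def insert_commute)
qed

lemma simple_graph_finite: "simple_graph G \<Longrightarrow> finite (snd G)"
  by (rule finite_subset[of _ "Pow {0..<fst G}"]) (auto simp: simple_graph_def)

lemma sdp_objective_edges:
  assumes G: "simple_graph G"
  shows "sdp_objective G w X = (\<Sum>f\<in>snd G. w f * edge_entry X f)"
proof -
  have "{Min f, Max f} = f \<and> Min f < Max f" if "f \<in> snd G" for f
    by (rule simple_graph_edgeE[OF G that]) simp
  then show ?thesis
    unfolding sdp_objective_def
    by (intro sum.reindex_bij_witness[of _ "\<lambda>f. (Min f, Max f)" "\<lambda>(i, j). {i, j}"])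
      (auto simp: edge_entry_def)
qed

lemma tendsto_sdp_objective:
  assumes G: "simple_graph G" and lim: "entrywise_limit (fst G) (fst G) X Z"
  shows "(\<lambda>k. sdp_objective G w (X k)) \<longlonglongrightarrow> sdp_objective G w Z"
proof -
  have "(\<lambda>k. edge_entry (X k) f) \<longlonglongrightarrow> edge_entry Z f" if "f \<in> snd G" for f
    by (rule simple_graph_edgeE[OF G that])
      (use lim in \<open>simp add: edge_entry_def entrywise_limit_def\<close>)
  then show ?thesis
    unfolding sdp_objective_edges[OF G] by (intro tendsto_intros)
qed

lemma sdp_optimum_exists:
  assumes G: "simple_graph G"
  shows "\<exists>X. is_arg_max (sdp_objective G w) (sdp_feasible (fst G)) X"
proof -
  let ?obj = "sdp_objective G w" and ?F = "{X. sdp_feasible (fst G) X}"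
  define M where "M = (SUP X\<in>?F. ?obj X)"
  have "?obj X \<le> (\<Sum>f\<in>snd G. \<bar>w f\<bar>)" if "sdp_feasible (fst G) X" for X
    unfolding sdp_objective_edges[OF G]
  proof (rule sum_mono)
    fix f assume "f \<in> snd G"
    then have "\<bar>edge_entry X f\<bar> \<le> 1"
      by (rule simple_graph_edgeE[OF G]) (simp add: edge_entry_def sdp_feasible_abs_le_1[OF that])
    then have "\<bar>w f * edge_entry X f\<bar> \<le> \<bar>w f\<bar>"
      by (simp add: abs_mult mult_left_le)
    then show "w f * edge_entry X f \<le> \<bar>w f\<bar>" by linarith
  qed
  then have bdd: "bdd_above (?obj ` ?F)" by (intro bdd_aboveI2) auto
  have nonempty: "?F \<noteq> {}" using sdp_feasible_one_mat by auto
  have "\<exists>X. sdp_feasible (fst G) X \<and> M - 1 / real (Suc k) < ?obj X" for k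
  proof -
    have "M - 1 / real (Suc k) < M" by simp
    then show ?thesis
      unfolding M_def using less_cSUP_iff[OF nonempty bdd] by auto
  qed
  then obtain X where X: "\<And>k. sdp_feasible (fst G) (X k)"
    and near: "\<And>k. M - 1 / real (Suc k) < ?obj (X k)" by metis
  obtain s :: "nat \<Rightarrow> nat" and Z where s: "strict_mono s" and Z: "sdp_feasible (fst G) Z"
    and lim: "entrywise_limit (fst G) (fst G) (\<lambda>k. X (s k)) Z"
    using sdp_feasible_compact[OF X] .
  have "(\<lambda>k. M - 1 / real (Suc k)) \<longlonglongrightarrow> M - 0"
    using LIMSEQ_inverse_real_of_nat by (intro tendsto_intros) (simp add: inverse_eq_divide)
  from LIMSEQ_subseq_LIMSEQ[OF this s]
  have "(\<lambda>k. M - 1 / real (Suc (s k))) \<longlonglongrightarrow> M" by (simp add: comp_def)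
  then have "M \<le> ?obj Z"
    by (rule LIMSEQ_le[OF _ tendsto_sdp_objective[OF G lim]]) (use less_imp_le[OF near] in auto)
  moreover have "?obj Y \<le> M" if "sdp_feasible (fst G) Y" for Y
    unfolding M_def using that by (intro cSUP_upper bdd) auto
  ultimately show ?thesis
    using Z by (intro exI[of _ Z]) (force simp: is_arg_max_def not_less)
qed

text \<open>The least positive \<open>r\<close> with this property is \<open>egd G\<close>.\<close>

definition optimal_rank_bound :: "graph \<Rightarrow> nat \<Rightarrow> bool" where
  "optimal_rank_bound G r \<longleftrightarrow> (\<forall>w. \<exists>X.
     is_arg_max (sdp_objective G w) (sdp_feasible (fst G)) X \<and> vec_space.rank (fst G) X \<le> r)"

text \<open>Optimal solutions exist and have rank at most the number of nodes, so \<open>LEAST\<close> ranges over a nonempty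
  set. The maximum with 1 covers the graph without nodes.\<close>

lemma egd_attained:
  assumes G: "simple_graph G"
  shows "1 \<le> egd G" "optimal_rank_bound G (egd G)"
proof -
  have "vec_space.rank (fst G) X \<le> max 1 (fst G)"
    if "sdp_feasible (fst G) X" for X
    using vec_space.rank_le_nc[OF sdp_feasible_carrier[OF that]] by simp
  then have "1 \<le> max 1 (fst G) \<and> optimal_rank_bound G (max 1 (fst G))"
    using sdp_optimum_exists[OF G] unfolding optimal_rank_bound_def is_arg_max_def by fastforce
  then have "1 \<le> egd G \<and> optimal_rank_bound G (egd G)"
    unfolding egd_def optimal_rank_bound_def[symmetric] by (rule LeastI)
  then show "1 \<le> egd G" "optimal_rank_bound G (egd G)" by auto
qed

lemma egd_le: "1 \<le> r \<Longrightarrow> optimal_rank_bound G r \<Longrightarrow> egd G \<le> r"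
  unfolding egd_def optimal_rank_bound_def[symmetric] by (rule Least_le) simp

section \<open>Deleting an edge\<close>

lemma simple_graph_delete_edge: "simple_graph G \<Longrightarrow> simple_graph (delete_edge G e)"
  by (auto simp: simple_graph_def delete_edge_def)

lemma optimal_rank_bound_delete_edge:
  assumes G: "simple_graph G" and e: "e \<in> snd G" and r: "optimal_rank_bound G r"
  shows "optimal_rank_bound (delete_edge G e) r"
proof -
  have "sdp_objective (delete_edge G e) w = sdp_objective G (w(e := 0))" for w
  proof
    fix X
    have "sdp_objective G (w(e := 0)) X = (\<Sum>f\<in>snd G - {e}. (w(e := 0)) f * edge_entry X f)"
      unfolding sdp_objective_edges[OF G]
      by (simp add: sum.remove[OF simple_graph_finite[OF G] e])
    also have "\<dots> = sdp_objective (delete_edge G e) w X"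
      unfolding sdp_objective_edges[OF simple_graph_delete_edge[OF G]] by (simp add: delete_edge_def)
    finally show "sdp_objective (delete_edge G e) w X = sdp_objective G (w(e := 0)) X" by simp
  qed
  then show ?thesis using r by (simp add: optimal_rank_bound_def delete_edge_def)
qed

section \<open>Contracting an edge\<close>

text \<open>The section of \<open>merge u v\<close> that avoids \<open>v\<close>.\<close>

definition unmerge :: "nat \<Rightarrow> nat \<Rightarrow> nat" where
  "unmerge v a = (if a < v then a else Suc a)"

lemma merge_less: "u < v \<Longrightarrow> v < n \<Longrightarrow> i < n \<Longrightarrow> merge u v i < n - 1"
  by (auto simp: merge_def)

lemma unmerge_less: "v < n \<Longrightarrow> a < n - 1 \<Longrightarrow> unmerge v a < n"
  by (auto simp: unmerge_def)

lemma unmerge_merge: "u < v \<Longrightarrow> unmerge v (merge u v i) = (if i = v then u else i)"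
  by (auto simp: merge_def unmerge_def)

lemma merge_eq_iff:
  "u < v \<Longrightarrow> merge u v i = merge u v j \<longleftrightarrow> i = j \<or> {i, j} = {u, v}"
  by (auto simp: merge_def doubleton_eq_iff split: if_splits)

lemma pullback_merge_unmerge:
  assumes X: "sdp_feasible n X" and uv: "u < v" "v < n" "X $$ (u, v) = 1"
  shows "pullback n (merge u v) (pullback (n - 1) (unmerge v) X) = X"
proof (rule eq_matI)
  have row: "X $$ (u, j) = X $$ (v, j)" if "j < n" for j
    using sdp_feasible_entry_1_imp_rows_eq[OF X _ _ uv(3) that] uv by simp
  have u: "u < n" using uv by simp
  have col: "X $$ (j, u) = X $$ (j, v)" if "j < n" for j
    using row[OF that] sdp_feasible_sym[OF X that u] sdp_feasible_sym[OF X that uv(2)] by simp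
  fix i j assume "i < dim_row X" "j < dim_col X"
  then have "i < n" "j < n" using sdp_feasible_carrier[OF X] by auto
  then show "pullback n (merge u v) (pullback (n - 1) (unmerge v) X) $$ (i, j) = X $$ (i, j)"
    using uv row col u merge_less[OF uv(1,2)] by (auto simp: unmerge_merge)
qed (use sdp_feasible_carrier[OF X] in auto)

lemma simple_graph_contract_edge:
  assumes G: "simple_graph G" and e: "e \<in> snd G"
  shows "simple_graph (contract_edge G e)"
proof -
  obtain u v where uv: "e = {u, v}" "u < v" "v < fst G" "Min e = u" "Max e = v"
    using simple_graph_edgeE[OF G e] .
  have "merge u v ` f \<subseteq> {0..<fst G - 1} \<and> card (merge u v ` f) = 2"
    if f: "f \<in> snd G" "f \<noteq> e" for f
  proof -
    obtain i j where ij: "f = {i, j}" "i < j" "j < fst G"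
      using simple_graph_edgeE[OF G f(1)] .
    then have "merge u v i \<noteq> merge u v j"
      using f(2) uv by (simp add: merge_eq_iff)
    then show ?thesis using ij merge_less[OF uv(2,3)] by simp
  qed
  then show ?thesis
    by (auto simp: simple_graph_def contract_edge_def uv(4,5))
qed

lemma edge_entry_pullback:
  assumes Y: "sdp_feasible p Y" and h: "\<And>i. i < n \<Longrightarrow> h i < p" and ij: "i < j" "j < n"
  shows "edge_entry (pullback n h Y) {i, j} = edge_entry Y (h ` {i, j})"
  using ij h[of i] h[of j] sdp_feasible_sym[OF Y, of "h i" "h j"]
  by (auto simp: edge_entry_def min_def max_def)

text \<open>Sharing the weight of \<open>f\<close> equally among its preimages preserves the weighted sum.\<close>

lemma sum_over_fibres:
  fixes w t :: "'b \<Rightarrow> real"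
  assumes "finite A"
  shows "(\<Sum>g\<in>A. w (h g) / real (card {x \<in> A. h x = h g}) * t (h g)) = (\<Sum>f\<in>h ` A. w f * t f)"
proof -
  have "(\<Sum>g\<in>A. w (h g) / real (card {x \<in> A. h x = h g}) * t (h g))
      = (\<Sum>f\<in>h ` A. \<Sum>g | g \<in> A \<and> h g = f. w (h g) / real (card {x \<in> A. h x = h g}) * t (h g))"
    by (rule sum.image_gen[OF assms])
  also have "\<dots> = (\<Sum>f\<in>h ` A. \<Sum>g | g \<in> A \<and> h g = f. w f / real (card {x \<in> A. h x = f}) * t f)"
    by (intro sum.cong) auto
  also have "\<dots> = (\<Sum>f\<in>h ` A. w f * t f)"
  proof (rule sum.cong)
    fix f assume "f \<in> h ` A"
    then have "card {x \<in> A. h x = f} \<noteq> 0" using assms by auto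
    then show "(\<Sum>g | g \<in> A \<and> h g = f. w f / real (card {x \<in> A. h x = f}) * t f) = w f * t f"
      by simp
  qed simp
  finally show ?thesis .
qed

text \<open>Parallel edges arise when \<open>u\<close> and \<open>v\<close> have a common neighbour; the weight of the resulting single
  edge is divided equally between them.\<close>

definition lift_weight :: "graph \<Rightarrow> nat set \<Rightarrow> (nat set \<Rightarrow> real) \<Rightarrow> real \<Rightarrow> nat set \<Rightarrow> real" where
  "lift_weight G e w k g =
     (let m = (`) (merge (Min e) (Max e))
      in if g = e then k else w (m g) / real (card {x \<in> snd G - {e}. m x = m g}))"

lemma sdp_objective_lift_weight:
  assumes G: "simple_graph G" and e: "e \<in> snd G"
  shows "sdp_objective G (lift_weight G e w k) X =
    k * edge_entry X e + sdp_objective G (lift_weight G e w 0) X"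
  unfolding sdp_objective_edges[OF G] sum.remove[OF simple_graph_finite[OF G] e]
  by (simp add: lift_weight_def Let_def)

lemma sdp_objective_pullback_merge:
  assumes G: "simple_graph G" and e: "e \<in> snd G" and Y: "sdp_feasible (fst G - 1) Y"
  shows "sdp_objective G (lift_weight G e w k) (pullback (fst G) (merge (Min e) (Max e)) Y) =
    k + sdp_objective (contract_edge G e) w Y"
proof -
  obtain u v where uv: "e = {u, v}" "u < v" "v < fst G" "Min e = u" "Max e = v"
    using simple_graph_edgeE[OF G e] .
  let ?P = "pullback (fst G) (merge u v) Y" and ?A = "snd G - {e}" and ?m = "(`) (merge u v)"
  have less: "\<And>i. i < fst G \<Longrightarrow> merge u v i < fst G - 1" using uv merge_less by blast
  have "edge_entry ?P e = 1"
    using uv sdp_feasible_diag[OF Y less[of u]] by (simp add: edge_entry_def merge_def)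
  moreover have "edge_entry ?P f = edge_entry Y (?m f)" if f: "f \<in> snd G" for f
  proof -
    obtain i j where "f = {i, j}" "i < j" "j < fst G" using simple_graph_edgeE[OF G f] .
    then show ?thesis
      using edge_entry_pullback[of "fst G - 1" Y "fst G" "merge u v" i j] Y less by simp
  qed
  ultimately have "sdp_objective G (lift_weight G e w k) ?P
      = k + (\<Sum>g\<in>?A. w (?m g) / real (card {x \<in> ?A. ?m x = ?m g}) * edge_entry Y (?m g))"
    unfolding sdp_objective_edges[OF G] sum.remove[OF simple_graph_finite[OF G] e]
    by (simp add: lift_weight_def Let_def uv(4,5))
  also have "\<dots> = k + sdp_objective (contract_edge G e) w Y"
    unfolding sdp_objective_edges[OF simple_graph_contract_edge[OF G e]]
    using sum_over_fibres[of ?A w ?m "edge_entry Y"] simple_graph_finite[OF G]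
    by (simp add: contract_edge_def uv(4,5))
  finally show ?thesis by (simp add: uv(4,5))
qed

text \<open>This is the penalty argument: the weight \<open>k + 1\<close> on \<open>e\<close> drives the entry at \<open>(u, v)\<close> to 1 as \<open>k\<close>
  grows.\<close>

lemma optimal_rank_bound_contract_edge:
  assumes G: "simple_graph G" and e: "e \<in> snd G" and r: "optimal_rank_bound G r"
  shows "optimal_rank_bound (contract_edge G e) r"
  unfolding optimal_rank_bound_def
proof
  fix w
  obtain u v where uv: "e = {u, v}" "u < v" "v < fst G" "Min e = u" "Max e = v"
    using simple_graph_edgeE[OF G e] .
  define n where "n = fst G"
  have n: "fst G = n" "fst (contract_edge G e) = n - 1" "u < n" "v < n"
    using uv by (auto simp: n_def contract_edge_def)
  let ?F = "sdp_objective G (lift_weight G e w 0)"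
  have "\<exists>X. is_arg_max (sdp_objective G (lift_weight G e w (real (Suc k)))) (sdp_feasible n) X
      \<and> vec_space.rank n X \<le> r" for k
    using r by (auto simp: optimal_rank_bound_def n)
  then obtain X where
    opt: "\<And>k. is_arg_max (sdp_objective G (lift_weight G e w (real (Suc k)))) (sdp_feasible n) (X k)"
    and rank: "\<And>k. vec_space.rank n (X k) \<le> r" by metis
  have X: "\<And>k. sdp_feasible n (X k)" using opt by (simp add: is_arg_max_def)
  obtain s :: "nat \<Rightarrow> nat" and Z where s: "strict_mono s" and Z: "sdp_feasible n Z"
    and lim: "entrywise_limit n n (\<lambda>k. X (s k)) Z"
    using sdp_feasible_compact[OF X] .
  have limF: "(\<lambda>k. ?F (X (s k))) \<longlonglongrightarrow> ?F Z"
    using tendsto_sdp_objective[OF G] lim by (simp add: n)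
  have limuv: "(\<lambda>k. X (s k) $$ (u, v)) \<longlonglongrightarrow> Z $$ (u, v)"
    using lim n by (simp add: entrywise_limit_def)
  \<comment> \<open>Optimality against a competitor with equal rows \<open>u\<close> and \<open>v\<close>, whose objective
    is \<open>k + 1\<close> plus its value on the contracted graph.\<close>
  have compare: "real (Suc k) * (1 - X k $$ (u, v)) \<le> ?F (X k) - sdp_objective (contract_edge G e) w Y"
    if Y: "sdp_feasible (n - 1) Y" for k Y
  proof -
    have "sdp_feasible n (pullback n (merge u v) Y)"
      using merge_less uv n by (intro sdp_feasible_pullback[OF Y]) auto
    then have "sdp_objective G (lift_weight G e w (real (Suc k))) (pullback n (merge u v) Y)
        \<le> sdp_objective G (lift_weight G e w (real (Suc k))) (X k)"
      using opt[of k] by (auto simp: is_arg_max_def not_less)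
    then have "real (Suc k) + sdp_objective (contract_edge G e) w Y
        \<le> real (Suc k) * X k $$ (u, v) + ?F (X k)"
      using sdp_objective_pullback_merge[OF G e, of Y w "real (Suc k)"] Y
        sdp_objective_lift_weight[OF G e, of w "real (Suc k)" "X k"]
      by (simp add: n uv(4,5) edge_entry_def)
    then show ?thesis by (simp add: algebra_simps)
  qed
  have le1: "X k $$ (u, v) \<le> 1" for k
    using sdp_feasible_abs_le_1[OF X n(3,4)] by (simp add: abs_le_iff)
  \<comment> \<open>The right-hand side above converges along the subsequence, so it vanishes in the limit after
    division by the weight of \<open>e\<close>. Any competitor serves here, for instance the identity.\<close>
  have "1 - Z $$ (u, v) \<le> 0"
  proof (rule LIMSEQ_le)
    define b where "b = sdp_objective (contract_edge G e) w (1\<^sub>m (n - 1))"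
    show "(\<lambda>k. 1 - X (s k) $$ (u, v)) \<longlonglongrightarrow> 1 - Z $$ (u, v)"
      by (intro tendsto_intros limuv)
    have "(\<lambda>k. inverse (real (Suc (s k)))) \<longlonglongrightarrow> 0"
      using LIMSEQ_subseq_LIMSEQ[OF LIMSEQ_inverse_real_of_nat s] by (simp add: comp_def)
    then have "(\<lambda>k. (?F (X (s k)) - b) * inverse (real (Suc (s k)))) \<longlonglongrightarrow> (?F Z - b) * 0"
      by (intro tendsto_intros limF)
    then show "(\<lambda>k. (?F (X (s k)) - b) / real (Suc (s k))) \<longlonglongrightarrow> 0"
      by (simp add: divide_inverse)
    show "\<exists>N. \<forall>k\<ge>N. 1 - X (s k) $$ (u, v) \<le> (?F (X (s k)) - b) / real (Suc (s k))"
      using compare[OF sdp_feasible_one_mat] by (auto simp: b_def pos_le_divide_eq mult.commute)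
  qed
  then have "Z $$ (u, v) = 1"
    using sdp_feasible_abs_le_1[OF Z n(3,4)] by simp
  define W where "W = pullback (n - 1) (unmerge v) Z"
  have W: "sdp_feasible (n - 1) W"
    unfolding W_def using unmerge_less n by (intro sdp_feasible_pullback[OF Z]) auto
  have "pullback n (merge u v) W = Z"
    unfolding W_def by (rule pullback_merge_unmerge[OF Z uv(2) n(4)]) fact
  then have FZ: "?F Z = sdp_objective (contract_edge G e) w W"
    using sdp_objective_pullback_merge[OF G e, of W w 0] W by (simp add: n uv(4,5))
  \<comment> \<open>The penalty \<open>(k + 1) (1 - (X\<^sub>k)\<^sub>u\<^sub>v)\<close> is nonnegative, so the remaining part
    of the objective bounds every competitor already before the limit is taken.\<close>
  have "sdp_objective (contract_edge G e) w Y \<le> sdp_objective (contract_edge G e) w W"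
    if Y: "sdp_feasible (n - 1) Y" for Y
  proof -
    have "sdp_objective (contract_edge G e) w Y \<le> ?F (X (s k))" for k
    proof -
      have "0 \<le> real (Suc (s k)) * (1 - X (s k) $$ (u, v))"
        using le1 by (intro mult_nonneg_nonneg) auto
      then show ?thesis using compare[OF Y, of "s k"] by linarith
    qed
    then show ?thesis
      using LIMSEQ_le_const[OF limF] FZ by auto
  qed
  then have "is_arg_max (sdp_objective (contract_edge G e) w) (sdp_feasible (n - 1)) W"
    using W by (auto simp: is_arg_max_def not_less)
  moreover have "vec_space.rank (n - 1) W \<le> r"
  proof -
    have "vec_space.rank (n - 1) W \<le> vec_space.rank n Z"
      unfolding W_def using unmerge_less n
      by (intro rank_pullback_le[OF sdp_feasible_carrier[OF Z]]) auto
    also have "\<dots> \<le> r"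
      by (rule rank_limit_le[OF sdp_feasible_carrier[OF X] sdp_feasible_carrier[OF Z] lim rank])
    finally show ?thesis .
  qed
  ultimately show "\<exists>X. is_arg_max (sdp_objective (contract_edge G e) w)
      (sdp_feasible (fst (contract_edge G e))) X \<and> vec_space.rank (fst (contract_edge G e)) X \<le> r"
    by (auto simp: n)
qed

theorem lemma3p1:
  fixes G :: graph and e :: "nat set"
  assumes "simple_graph G" and "e \<in> snd G"
  shows "egd (delete_edge G e) \<le> egd G \<and> egd (contract_edge G e) \<le> egd G"
  using egd_attained[OF assms(1)] optimal_rank_bound_delete_edge[OF assms]
    optimal_rank_bound_contract_edge[OF assms] by (blast intro: egd_le)

end
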